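(* (1) Let $k\ge 2$ be an integer, let $N$ be a uniformly discrete metric space with $\operatorname{OR}_N(k)=k$, and let $\alpha$ be a quasi-isometric embedding of $N$ into a metric space $M$. Then $\operatorname{OR}_M(k)=k$. (2) In particular, if $N$ and $M$ are quasi-isometric uniformly discrete metric spaces, then $\operatorname{Br}(N)=\operatorname{Br}(M)$.
   Context: All orders are total orders. Let $(M,d)$ be a metric space. For a finite subset $X\subset M$, $l_{\mathrm{opt}}(X)$ is the minimum of $\sum_{i=1}^{m-1} d(y_i,y_{i+1})$ over all enumerations $y_1,\dots,y_m$ of $X$. If $T$ is an order on $M$ and $x_1<_T\dots<_T x_m$ are the points of $X$, put $l_T(X)=\sum_{i=1}^{m-1} d(x_i,x_{i+1})$. If $M$ has at least two points, then for $k\ge 1$ $$\operatorname{OR}_{M,T}(k)=\sup_{X\subset M,\ 2\le \#X\le k+1}\frac{l_T(X)}{l_{\mathrm{opt}}(X)};$$ if $M$ is a single point, $\operatorname{OR}_{M,T}(k)=1$ for all $k\ge1$. Put $\operatorname{OR}_M(k)=\inf_T\operatorname{OR}_{M,T}(k)$ over all orders $T$ on $M$. The order breakpoint $\operatorname{Br}(M,T)$ is the smallest integer $s\ge 1$ such that $\operatorname{OR}_{M,T}(s)<s$ ($\infty$ if no such $s$ exists), and $\operatorname{Br}(M)=\min_T \operatorname{Br}(M,T)$ over all orders $T$ on $M$. A metric space is uniformly discrete if there is $\delta>0$ such that any two distinct points are at distance at least $\delta$. A map $\alpha:N\to M$ is a quasi-isometric embedding if there are $C_1\ge1$, $C_2\ge0$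 with $\frac1{C_1}d_N(x_1,x_2)-C_2\le d_M(\alpha(x_1),\alpha(x_2))\le C_1d_N(x_1,x_2)+C_2$ for all $x_1,x_2\in N$; it is a quasi-isometry if moreover $M$ is at bounded distance from $\alpha(N)$. *)

theory Defs
  imports "HOL-Analysis.Analysis" "HOL-Combinatorics.Multiset_Permutations" "HOL-Library.Extended_Nat"
begin

text \<open>
  A metric space is represented by a set \<open>M\<close> of points of a type of class \<open>metric_space\<close>,
  with the induced metric \<^const>\<open>dist\<close>; an order on \<open>M\<close> is a relation \<open>T\<close> with
  \<^prop>\<open>linear_order_on M T\<close>, where \<open>(x, y) \<in> T\<close> reads \<open>x \<le>\<^sub>T y\<close>.
\<close>

definition path_length :: "'a::metric_space list \<Rightarrow> real" where
  "path_length ys = (\<Sum>i<length ys - 1. dist (ys ! i) (ys ! Suc i))"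

definition l_opt :: "'a::metric_space set \<Rightarrow> real" where
  "l_opt X = Min (path_length ` permutations_of_set X)"

definition order_enum :: "'a rel \<Rightarrow> 'a set \<Rightarrow> 'a list" where
  "order_enum T X = (THE xs. xs \<in> permutations_of_set X \<and> sorted_wrt (\<lambda>x y. (x, y) \<in> T) xs)"

definition l_ord :: "'a::metric_space rel \<Rightarrow> 'a set \<Rightarrow> real" where
  "l_ord T X = path_length (order_enum T X)"

text \<open>
  The supremum is taken in the reals; for \<open>k \<ge> 1\<close> it ranges over a nonempty set bounded by \<open>k\<close>
  (lemmas \<open>ord_ratio_sets_nonempty\<close> and \<open>ord_ratio_le\<close> below). The value \<open>1\<close> for one-point
  spaces is also used for the empty set, which is not meant to be a metric space here.
\<close>

definition ord_ratio_wrt :: "'a::metric_space set \<Rightarrow> 'a rel \<Rightarrow> nat \<Rightarrow> real" where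
  "ord_ratio_wrt M T k =
     (if \<exists>x\<in>M. \<exists>y\<in>M. x \<noteq> y
      then (SUP X\<in>{X. X \<subseteq> M \<and> finite X \<and> 2 \<le> card X \<and> card X \<le> k + 1}. l_ord T X / l_opt X)
      else 1)"

definition ord_ratio :: "'a::metric_space set \<Rightarrow> nat \<Rightarrow> real" where
  "ord_ratio M k = (INF T\<in>{T. linear_order_on M T}. ord_ratio_wrt M T k)"

definition breakpoint_wrt :: "'a::metric_space set \<Rightarrow> 'a rel \<Rightarrow> enat" where
  "breakpoint_wrt M T =
     (if \<exists>s\<ge>1. ord_ratio_wrt M T s < real s
      then enat (LEAST s. 1 \<le> s \<and> ord_ratio_wrt M T s < real s)
      else \<infinity>)"

text \<open>The infimum of a nonempty set of extended naturals is attained, so this is a minimum.\<close>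

definition breakpoint :: "'a::metric_space set \<Rightarrow> enat" where
  "breakpoint M = (INF T\<in>{T. linear_order_on M T}. breakpoint_wrt M T)"

definition quasi_isometric_embedding ::
    "'a::metric_space set \<Rightarrow> 'b::metric_space set \<Rightarrow> ('a \<Rightarrow> 'b) \<Rightarrow> bool" where
  "quasi_isometric_embedding N M \<alpha> \<longleftrightarrow>
     \<alpha> \<in> N \<rightarrow> M \<and>
     (\<exists>C1\<ge>1. \<exists>C2\<ge>0. \<forall>x\<in>N. \<forall>y\<in>N.
        1 / C1 * dist x y - C2 \<le> dist (\<alpha> x) (\<alpha> y) \<and> dist (\<alpha> x) (\<alpha> y) \<le> C1 * dist x y + C2)"

definition quasi_isometry ::
    "'a::metric_space set \<Rightarrow> 'b::metric_space set \<Rightarrow> ('a \<Rightarrow> 'b) \<Rightarrow> bool" where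
  "quasi_isometry N M \<alpha> \<longleftrightarrow>
     quasi_isometric_embedding N M \<alpha> \<and> (\<exists>C. \<forall>y\<in>M. \<exists>x\<in>N. dist y (\<alpha> x) \<le> C)"

definition quasi_isometric :: "'a::metric_space set \<Rightarrow> 'b::metric_space set \<Rightarrow> bool" where
  "quasi_isometric N M \<longleftrightarrow> (\<exists>\<alpha>. quasi_isometry N M \<alpha>)"


subsection \<open>Well-definedness of the above\<close>

lemma linear_order_exists: "\<exists>T. linear_order_on M T"
proof -
  obtain r :: "'a rel" where "well_order_on M r"
    using well_order_on by blast
  then show ?thesis by (auto simp: well_order_on_def)
qed

lemma order_enum_ex1:
  assumes T: "linear_order_on M T" and X: "X \<subseteq> M" "finite X"
  shows "\<exists>!xs. xs \<in> permutations_of_set X \<and> sorted_wrt (\<lambda>x y. (x, y) \<in> T) xs"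
proof -
  have tr: "trans T" and an: "antisym T" and tot: "\<And>x y. x \<in> M \<Longrightarrow> y \<in> M \<Longrightarrow> (x, y) \<in> T \<or> (y, x) \<in> T"
    using T unfolding order_on_defs total_on_def refl_on_def by (blast, blast, metis)
  have "\<exists>xs. set xs = X \<and> distinct xs \<and> sorted_wrt (\<lambda>x y. (x, y) \<in> T) xs"
    using X(2,1)
  proof (induction X rule: finite_psubset_induct)
    case (psubset X)
    show ?case
    proof (cases "X = {}")
      case False
      have "\<exists>m\<in>X. \<forall>x\<in>X. (m, x) \<in> T"
        using psubset.hyps False psubset.prems
      proof (induction X rule: finite_ne_induct)
        case (singleton x) then show ?case using tot by auto
      next
        case (insert x F)
        then obtain m where m: "m \<in> F" "\<forall>y\<in>F. (m, y) \<in> T" by auto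
        have xx: "(x, x) \<in> T" using insert tot by blast
        have "(x, m) \<in> T \<or> (m, x) \<in> T" using insert.prems m(1) tot[of x m] by blast
        then show ?case
        proof
          assume "(x, m) \<in> T"
          then have "\<forall>y\<in>insert x F. (x, y) \<in> T" using m(2) xx tr by (metis insert_iff transD)
          then show ?thesis by blast
        next
          assume "(m, x) \<in> T"
          then show ?thesis using m by blast
        qed
      qed
      then obtain m where m: "m \<in> X" "\<forall>x\<in>X. (m, x) \<in> T" by blast
      have "X - {m} \<subset> X" using m by blast
      from psubset.IH[OF this] psubset.prems obtain xs
        where "set xs = X - {m}" "distinct xs" "sorted_wrt (\<lambda>x y. (x, y) \<in> T) xs" by auto
      then show ?thesis using m by (intro exI[of _ "m # xs"]) auto
    qed auto
  qed
  moreover have "xs = ys"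
    if "set xs = set ys" "distinct xs" "distinct ys"
       "sorted_wrt (\<lambda>x y. (x, y) \<in> T) xs" "sorted_wrt (\<lambda>x y. (x, y) \<in> T) ys" for xs ys
    using that
  proof (induction xs arbitrary: ys)
    case (Cons x xs)
    then obtain y ys' where y: "ys = y # ys'" by (cases ys) auto
    have "x = y"
    proof (rule ccontr)
      assume "x \<noteq> y"
      then have "(x, y) \<in> T" "(y, x) \<in> T" using Cons.prems y by auto
      then show False using an \<open>x \<noteq> y\<close> by (auto dest: antisymD)
    qed
    moreover have "set xs = set ys'" using Cons.prems y calculation by auto
    ultimately show ?case using Cons y by auto
  qed auto
  ultimately show ?thesis by (auto simp: permutations_of_set_def)
qed

lemma order_enum_works:
  assumes "linear_order_on M T" "X \<subseteq> M" "finite X"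
  shows "order_enum T X \<in> permutations_of_set X" "sorted_wrt (\<lambda>x y. (x, y) \<in> T) (order_enum T X)"
  using theI'[OF order_enum_ex1[OF assms]] unfolding order_enum_def by blast+

lemma dist_le_path_length:
  assumes "i \<le> j" "j < length ys"
  shows "dist (ys ! i) (ys ! j) \<le> path_length ys"
proof -
  have "dist (ys ! i) (ys ! j) \<le> (\<Sum>l\<in>{i..<j}. dist (ys ! l) (ys ! Suc l))"
    using assms(1)
  proof (induction j rule: dec_induct)
    case (step n)
    then show ?case using dist_triangle[of "ys ! i" "ys ! Suc n" "ys ! n"] by simp
  qed simp
  also have "\<dots> \<le> path_length ys"
    unfolding path_length_def using assms by (intro sum_mono2) auto
  finally show ?thesis .
qed

lemma dist_le_l_opt:
  assumes "finite X" "x \<in> X" "y \<in> X"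
  shows "dist x y \<le> l_opt X"
proof -
  have "path_length ` permutations_of_set X \<noteq> {}" using assms by simp
  then have "l_opt X \<in> path_length ` permutations_of_set X"
    unfolding l_opt_def by (intro Min_in) auto
  then obtain ys where ys: "set ys = X" "l_opt X = path_length ys"
    by (auto simp: permutations_of_set_def)
  then obtain i j where "i < length ys" "j < length ys" "x = ys ! i" "y = ys ! j"
    using assms by (auto simp: in_set_conv_nth)
  then show ?thesis
    using ys dist_le_path_length[of i j ys] dist_le_path_length[of j i ys]
    by (cases "i \<le> j") (auto simp: dist_commute)
qed

lemma l_opt_pos:
  assumes "finite X" "2 \<le> card X"
  shows "0 < l_opt X"
proof -
  obtain x y where "x \<in> X" "y \<in> X" "x \<noteq> y"
    using assms by (metis card_le_Suc0_iff_eq not_less_eq_eq numeral_2_eq_2)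
  then show ?thesis using dist_le_l_opt[OF assms(1), of x y] by (metis less_le_trans zero_less_dist_iff)
qed

lemma ord_ratio_le:
  assumes "linear_order_on M T" "X \<subseteq> M" "finite X" "2 \<le> card X" "card X \<le> k + 1"
  shows "l_ord T X / l_opt X \<le> real k"
proof -
  define xs where "xs = order_enum T X"
  have xs: "set xs = X" "distinct xs"
    using order_enum_works(1)[OF assms(1-3)] by (auto simp: xs_def permutations_of_set_def)
  have len: "length xs = card X" using xs distinct_card by fastforce
  have "path_length xs \<le> (\<Sum>i<length xs - 1. l_opt X)"
    unfolding path_length_def
    by (intro sum_mono dist_le_l_opt[OF assms(3)]) (use xs(1) in \<open>auto intro!: nth_mem\<close>)
  also have "\<dots> \<le> real k * l_opt X"
    using l_opt_pos[OF assms(3,4)] assms(5) len by simp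
  finally show ?thesis
    using l_opt_pos[OF assms(3,4)] by (simp add: l_ord_def xs_def divide_le_eq)
qed

lemma ord_ratio_sets_nonempty:
  assumes "x \<in> M" "y \<in> M" "x \<noteq> y" "1 \<le> k"
  shows "{X. X \<subseteq> M \<and> finite X \<and> 2 \<le> card X \<and> card X \<le> k + 1} \<noteq> {}"
proof -
  have "{x, y} \<in> {X. X \<subseteq> M \<and> finite X \<and> 2 \<le> card X \<and> card X \<le> k + 1}"
    using assms by auto
  then show ?thesis by blast
qed

text \<open>So the infimum over all orders is also over a nonempty set that is bounded below.\<close>

lemma ord_ratio_wrt_ge_1:
  assumes T: "linear_order_on M T" and k: "1 \<le> k"
  shows "1 \<le> ord_ratio_wrt M T k"
proof (cases "\<exists>x\<in>M. \<exists>y\<in>M. x \<noteq> y")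
  case True
  then obtain x y where xy: "x \<in> M" "y \<in> M" "x \<noteq> y" by blast
  define \<X> where "\<X> = {X. X \<subseteq> M \<and> finite X \<and> 2 \<le> card X \<and> card X \<le> k + 1}"
  have X: "{x, y} \<in> \<X>" using xy k by (auto simp: \<X>_def)
  have fX: "{x, y} \<subseteq> M" "finite {x, y}" "2 \<le> card {x, y}" using xy by auto
  have "l_opt {x, y} \<le> l_ord T {x, y}"
    unfolding l_ord_def l_opt_def using order_enum_works(1)[OF T fX(1,2)] by (intro Min_le) auto
  then have "1 \<le> l_ord T {x, y} / l_opt {x, y}" using l_opt_pos[OF fX(2,3)] by simp
  also have "\<dots> \<le> (SUP X\<in>\<X>. l_ord T X / l_opt X)"
    by (rule cSUP_upper[OF X]) (auto simp: bdd_above_def \<X>_def intro!: exI[of _ "real k"] ord_ratio_le[OF T])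
  finally show ?thesis using True by (simp add: ord_ratio_wrt_def \<X>_def)
qed (auto simp: ord_ratio_wrt_def)

end

theory Submission
  imports Defs
begin

text \<open>
  A set of \<open>k + 1\<close> points whose ratio is close to \<open>k\<close> is a long snake: in increasing order its points
  alternate between two clusters whose diameters are small compared with their distance.
  This is seen by placing the points on the interval \<open>[0, l_opt X]\<close> along an optimal path, where
  consecutive points of the order must lie near opposite ends. Conversely long snakes have ratio
  close to \<open>k\<close>. For \<open>k \<ge> 2\<close> one cluster has two points, so in a uniformly discrete space the
  cluster diameters are bounded below and long snakes have large separation. Pull an order on \<open>M\<close>
  back along \<open>\<alpha>\<close>, breaking ties arbitrarily: long snakes for the pulled back order are mapped to
  long snakes, since their consecutive points are too far apart to be identified by \<open>\<alpha>\<close>.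
\<close>

definition long_snakes :: "'a::metric_space set \<Rightarrow> 'a rel \<Rightarrow> nat \<Rightarrow> bool" where
  "long_snakes M T k \<longleftrightarrow>
     (\<forall>c>0. \<exists>z w. 0 < w \<and> (\<forall>i\<le>k. z i \<in> M) \<and>
        (\<forall>i<k. (z i, z (Suc i)) \<in> T \<and> c * w \<le> dist (z i) (z (Suc i))) \<and>
        (\<forall>i\<le>k. \<forall>j\<le>k. even i = even j \<longrightarrow> dist (z i) (z j) \<le> w))"

section \<open>Positions along an optimal path\<close>

lemma l_opt_attained:
  assumes "finite X"
  obtains ys where "ys \<in> permutations_of_set X" "l_opt X = path_length ys"
proof -
  have "l_opt X \<in> path_length ` permutations_of_set X"
    unfolding l_opt_def using assms by (intro Min_in) auto
  then show thesis using that by blast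
qed

text \<open>\<open>f x\<close> is the arc length from the start of an optimal path to
  \<open>x\<close>. The triangle inequality bounds a distance by the length of the path in
  between.\<close>

lemma l_opt_position:
  assumes "finite X"
  obtains f where "\<And>x. x \<in> X \<Longrightarrow> 0 \<le> f x \<and> f x \<le> l_opt X"
    "\<And>x y. x \<in> X \<Longrightarrow> y \<in> X \<Longrightarrow> dist x y \<le> \<bar>f x - f y\<bar>"
proof -
  obtain ys where "ys \<in> permutations_of_set X" and L: "l_opt X = path_length ys"
    using l_opt_attained[OF assms] .
  then have ys: "set ys = X" by (auto simp: permutations_of_set_def)
  define p where "p j = (\<Sum>l<j. dist (ys ! l) (ys ! Suc l))" for j
  have p: "0 \<le> p j \<and> p j \<le> path_length ys" if "j < length ys" for j
    unfolding p_def path_length_def using that by (auto intro!: sum_nonneg sum_mono2)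
  have d: "dist (ys ! i) (ys ! j) \<le> p j - p i" if "i \<le> j" for i j
    using that
  proof (induction j rule: dec_induct)
    case (step n)
    then show ?case using dist_triangle[of "ys ! i" "ys ! Suc n" "ys ! n"] by (simp add: p_def)
  qed simp
  have d': "dist (ys ! i) (ys ! j) \<le> \<bar>p i - p j\<bar>" for i j
    using d[of i j] d[of j i] by (cases "i \<le> j") (auto simp: dist_commute)
  have "\<forall>x\<in>X. \<exists>j. j < length ys \<and> ys ! j = x"
    by (simp add: in_set_conv_nth flip: ys)
  then obtain g where g: "\<And>x. x \<in> X \<Longrightarrow> g x < length ys \<and> ys ! g x = x"
    unfolding bchoice_iff by blast
  have "0 \<le> p (g x) \<and> p (g x) \<le> l_opt X" if "x \<in> X" for x
    using p[of "g x"] g[OF that] L by simp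
  moreover have "dist x y \<le> \<bar>p (g x) - p (g y)\<bar>" if "x \<in> X" "y \<in> X" for x y
    using d'[of "g x" "g y"] g[OF that(1)] g[OF that(2)] by simp
  ultimately show thesis by (rule that)
qed

text \<open>A step of length at least \<open>L - e\<close> inside [0, L] leads from the zone of
  width \<open>e\<close> at one end to the zone at the other end. Hence the parity of the index
  decides the zone.\<close>

lemma zigzag_same_parity_close:
  fixes g :: "nat \<Rightarrow> real"
  assumes e: "2 * e < L" and k: "0 < k"
    and g: "\<And>i. i \<le> k \<Longrightarrow> 0 \<le> g i \<and> g i \<le> L"
    and far: "\<And>i. i < k \<Longrightarrow> L - e \<le> \<bar>g i - g (Suc i)\<bar>"
    and ij: "i \<le> k" "j \<le> k" "even i = even j"
  shows "\<bar>g i - g j\<bar> \<le> e"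
proof -
  have low: "L - e \<le> g (Suc i)" if "i < k" "g i \<le> e" for i
    using far[OF that(1)] g[of i] g[of "Suc i"] e that by linarith
  have high: "g (Suc i) \<le> e" if "i < k" "L - e \<le> g i" for i
    using far[OF that(1)] g[of i] g[of "Suc i"] e that by linarith
  have "g 0 \<le> e \<or> L - e \<le> g 0"
    using far[of 0] g[of 0] g[of 1] k by auto
  then have "(\<forall>i\<le>k. if even i then g i \<le> e else L - e \<le> g i) \<or>
    (\<forall>i\<le>k. if even i then L - e \<le> g i else g i \<le> e)"
  proof
    assume 0: "g 0 \<le> e"
    have "if even i then g i \<le> e else L - e \<le> g i" if "i \<le> k" for i
      using that by (induction i) (use 0 low high in \<open>auto split: if_splits\<close>)
    then show ?thesis by blast
  next
    assume 0: "L - e \<le> g 0"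
    have "if even i then L - e \<le> g i else g i \<le> e" if "i \<le> k" for i
      using that by (induction i) (use 0 low high in \<open>auto split: if_splits\<close>)
    then show ?thesis by blast
  qed
  then have "g i \<le> e \<and> g j \<le> e \<or> L - e \<le> g i \<and> L - e \<le> g j"
    using ij by (auto split: if_splits)
  then show ?thesis using g[OF ij(1)] g[OF ij(2)] by linarith
qed

section \<open>Upper bounds for the order ratio\<close>

lemma ord_ratio_wrt_le:
  assumes "linear_order_on M T" "1 \<le> k"
  shows "ord_ratio_wrt M T k \<le> real k"
proof (cases "\<exists>x\<in>M. \<exists>y\<in>M. x \<noteq> y")
  case True
  then obtain x y where "x \<in> M" "y \<in> M" "x \<noteq> y" by blast
  then have "(SUP X\<in>{X. X \<subseteq> M \<and> finite X \<and> 2 \<le> card X \<and> card X \<le> k + 1}. l_ord T X / l_opt X)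
      \<le> real k"
    by (intro cSUP_least ord_ratio_sets_nonempty) (use assms ord_ratio_le in auto)
  then show ?thesis using True by (simp add: ord_ratio_wrt_def)
qed (use assms in \<open>auto simp: ord_ratio_wrt_def\<close>)

lemma bdd_above_ord_ratios:
  assumes "linear_order_on M T"
  shows "bdd_above ((\<lambda>X. l_ord T X / l_opt X) `
    {X. X \<subseteq> M \<and> finite X \<and> 2 \<le> card X \<and> card X \<le> k + 1})"
  by (rule bdd_aboveI2[of _ _ "real k"]) (use assms ord_ratio_le in auto)

section \<open>From ratio k to long snakes\<close>

lemma long_snakes_if_ord_ratio_wrt_eq:
  assumes T: "linear_order_on M T" and k: "2 \<le> k" and eq: "ord_ratio_wrt M T k = real k"
  shows "long_snakes M T k"
  unfolding long_snakes_def
proof (intro allI impI)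
  fix c :: real
  assume c: "0 < c"
  \<comment> \<open>The snake will have width \<open>e * L\<close> and steps of length at least
    \<open>(1 - e) * L\<close>, so \<open>c * e \<le> 1 - e\<close> is required;
    \<open>2 * e < 1\<close> keeps the two end zones apart.\<close>
  define e where "e = 1 / (c + 2)"
  have e: "0 < e" "2 * e < 1" "c * e \<le> 1 - e"
    using c by (auto simp: e_def field_simps)
  define \<X> where "\<X> = {X. X \<subseteq> M \<and> finite X \<and> 2 \<le> card X \<and> card X \<le> k + 1}"
  \<comment> \<open>Otherwise the default value 1 applies, which differs from \<open>k\<close>
    because \<open>k \<ge> 2\<close>.\<close>
  have nontriv: "\<exists>x\<in>M. \<exists>y\<in>M. x \<noteq> y"
  proof (rule ccontr)
    assume "\<not> ?thesis"
    then have "ord_ratio_wrt M T k = 1" unfolding ord_ratio_wrt_def by (simp only: if_False)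
    with eq k show False by simp
  qed
  then have "\<X> \<noteq> {}"
    unfolding \<X>_def using k ord_ratio_sets_nonempty[of _ M _ k] by fastforce
  moreover have "real k - e < (SUP X\<in>\<X>. l_ord T X / l_opt X)"
    using eq e nontriv by (simp add: ord_ratio_wrt_def \<X>_def)
  ultimately obtain X where "X \<in> \<X>" and big: "real k - e < l_ord T X / l_opt X"
    using less_cSUP_iff[OF _ bdd_above_ord_ratios[OF T, of k, folded \<X>_def]] by blast
  then have X: "X \<subseteq> M" "finite X" "2 \<le> card X" "card X \<le> k + 1" by (auto simp: \<X>_def)
  \<comment> \<open>With at most \<open>k\<close> points the ratio would be at most
    \<open>k - 1\<close>, below \<open>k - e\<close>; so \<open>X\<close> has exactly
    \<open>k + 1\<close> points.\<close>
  have "l_ord T X / l_opt X \<le> real (card X - 1)"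
    using ord_ratio_le[OF T X(1-3), of "card X - 1"] X(3) by simp
  then have "real k < real (card X)" using big e X(3) by (simp add: of_nat_diff)
  then have card: "card X = Suc k" using X(4) by linarith
  define L where "L = l_opt X"
  have L: "0 < L" using l_opt_pos X by (simp add: L_def)
  define xs where "xs = order_enum T X"
  have xs: "set xs = X" "distinct xs" "sorted_wrt (\<lambda>x y. (x, y) \<in> T) xs"
    using order_enum_works[OF T X(1,2)] by (auto simp: xs_def permutations_of_set_def)
  have len: "length xs = Suc k" using xs card distinct_card by fastforce
  have mem: "xs ! i \<in> X" if "i \<le> k" for i
    using that len xs(1) nth_mem[of i xs] by auto
  have sum: "(real k - e) * L < (\<Sum>i<k. dist (xs ! i) (xs ! Suc i))"
    using big L by (simp add: l_ord_def xs_def[symmetric] L_def[symmetric] path_length_def len less_divide_eq)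
  \<comment> \<open>The other \<open>k - 1\<close> steps contribute at most \<open>L\<close> each,
    so no single step can fall short of \<open>L\<close> by more than \<open>e * L\<close>.\<close>
  have far: "(1 - e) * L \<le> dist (xs ! i) (xs ! Suc i)" if "i < k" for i
  proof -
    have "(\<Sum>j<k. dist (xs ! j) (xs ! Suc j)) =
        dist (xs ! i) (xs ! Suc i) + (\<Sum>j\<in>{..<k} - {i}. dist (xs ! j) (xs ! Suc j))"
      using that by (subst sum.remove[of _ i]) auto
    also have "(\<Sum>j\<in>{..<k} - {i}. dist (xs ! j) (xs ! Suc j)) \<le> (\<Sum>j\<in>{..<k} - {i}. L)"
      unfolding L_def by (intro sum_mono dist_le_l_opt X mem) auto
    also have "\<dots> = (real k - 1) * L" using that by (simp add: of_nat_diff)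
    finally show ?thesis using sum by (simp add: algebra_simps)
  qed
  obtain f where f: "\<And>x. x \<in> X \<Longrightarrow> 0 \<le> f x \<and> f x \<le> L"
    "\<And>x y. x \<in> X \<Longrightarrow> y \<in> X \<Longrightarrow> dist x y \<le> \<bar>f x - f y\<bar>"
    using l_opt_position[OF X(2)] unfolding L_def by metis
  \<comment> \<open>The inequality for \<open>f\<close> serves twice: far points have far positions,
    and the close positions given by the zigzag lemma come from close points.\<close>
  have close: "dist (xs ! i) (xs ! j) \<le> e * L" if "i \<le> k" "j \<le> k" "even i = even j" for i j
  proof -
    have "\<bar>f (xs ! i) - f (xs ! j)\<bar> \<le> e * L"
    proof (rule zigzag_same_parity_close[of "e * L" L k "\<lambda>i. f (xs ! i)"])
      show "2 * (e * L) < L" using e(2) L by simp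
      show "L - e * L \<le> \<bar>f (xs ! i) - f (xs ! Suc i)\<bar>" if "i < k" for i
        using far[OF that] f(2)[of "xs ! i" "xs ! Suc i"] mem[of i] mem[of "Suc i"] that
        by (simp add: algebra_simps)
    qed (use k that f(1) mem in auto)
    then show ?thesis using f(2)[OF mem mem] that by fastforce
  qed
  show "\<exists>z w. 0 < w \<and> (\<forall>i\<le>k. z i \<in> M) \<and>
      (\<forall>i<k. (z i, z (Suc i)) \<in> T \<and> c * w \<le> dist (z i) (z (Suc i))) \<and>
      (\<forall>i\<le>k. \<forall>j\<le>k. even i = even j \<longrightarrow> dist (z i) (z j) \<le> w)"
  proof (intro exI conjI allI impI)
    show "0 < e * L" using e L by simp
    show "xs ! i \<in> M" if "i \<le> k" for i using mem[OF that] X by blast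
    show "(xs ! i, xs ! Suc i) \<in> T" if "i < k" for i
      using sorted_wrt_nth_less[OF xs(3), of i "Suc i"] that len by simp
    show "c * (e * L) \<le> dist (xs ! i) (xs ! Suc i)" if "i < k" for i
      using far[OF that] mult_right_mono[OF e(3), of L] L
      unfolding mult.assoc[symmetric] by linarith
  qed (use close in auto)
qed

section \<open>From long snakes to ratio k\<close>

text \<open>The path exhausts one cluster before entering the other, so the large distance
  \<open>d\<close> is paid only once.\<close>

lemma path_length_two_clusters:
  assumes xs: "\<And>x y. x \<in> set xs \<Longrightarrow> y \<in> set xs \<Longrightarrow> dist x y \<le> w"
    and ys: "\<And>x y. x \<in> set ys \<Longrightarrow> y \<in> set ys \<Longrightarrow> dist x y \<le> w"
    and xys: "\<And>x y. x \<in> set xs \<Longrightarrow> y \<in> set ys \<Longrightarrow> dist x y \<le> d"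
    and nonneg: "0 \<le> w" "0 \<le> d"
  shows "path_length (xs @ ys) \<le> real (length (xs @ ys)) * w + d"
proof -
  let ?zs = "xs @ ys"
  have "path_length ?zs \<le>
      (\<Sum>i<length ?zs - 1. w + (if i = length xs - 1 then d else 0))"
    unfolding path_length_def
  proof (rule sum_mono)
    fix i assume i: "i \<in> {..<length ?zs - 1}"
    consider "Suc i < length xs" | "Suc i = length xs" | "length xs \<le> i" by linarith
    then show "dist (?zs ! i) (?zs ! Suc i) \<le> w + (if i = length xs - 1 then d else 0)"
    proof cases
      case 1
      then show ?thesis using xs[of "xs ! i" "xs ! Suc i"] nonneg by (auto simp: nth_append)
    next
      case 2
      then have "ys \<noteq> []" using i by auto
      then have "dist (xs ! i) (ys ! 0) \<le> d" using xys 2 by simp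
      then show ?thesis using 2 nonneg by (simp add: nth_append flip: 2)
    next
      case 3
      then show ?thesis
        using ys[of "ys ! (i - length xs)" "ys ! Suc (i - length xs)"] nonneg i
        by (auto simp: nth_append Suc_diff_le)
    qed
  qed
  also have "\<dots> \<le> real (length ?zs - 1) * w + d"
    using nonneg by (simp add: sum.distrib sum.delta)
  also have "\<dots> \<le> real (length ?zs) * w + d"
    using nonneg by (intro add_right_mono mult_right_mono) auto
  finally show ?thesis .
qed

lemma order_enum_eqI:
  assumes T: "linear_order_on M T" and X: "X \<subseteq> M"
    and xs: "set xs = X" "distinct xs" "sorted_wrt (\<lambda>x y. (x, y) \<in> T) xs"
  shows "order_enum T X = xs"
  unfolding order_enum_def using xs
  by (intro the1_equality order_enum_ex1[OF T X]) (auto simp: permutations_of_set_def)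

text \<open>If the clusters are about \<open>d\<close> apart, following the order costs about
  \<open>k * d\<close>, whereas visiting all even indices before the odd ones costs about
  \<open>d\<close>. The errors are multiples of \<open>w\<close>, negligible against
  \<open>d\<close> for large \<open>c\<close>.\<close>

lemma ord_ratio_wrt_eq_if_long_snakes:
  assumes T: "linear_order_on M T" and k: "2 \<le> k" and snakes: "long_snakes M T k"
  shows "ord_ratio_wrt M T k = real k"
proof (rule antisym)
  show "ord_ratio_wrt M T k \<le> real k" using ord_ratio_wrt_le[OF T] k by simp
  have tr: "trans T" and an: "antisym T"
    using T unfolding order_on_defs by blast+
  show "real k \<le> ord_ratio_wrt M T k"
  proof (rule field_le_epsilon)
    fix e :: real
    assume e: "0 < e"
    \<comment> \<open>The factor \<open>k + 5\<close> collects the loss \<open>2 * w\<close> per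
      step in the lower bound for \<open>l_ord\<close> and the excess \<open>(k + 3) * w\<close> in
      the upper bound for \<open>l_opt\<close>.\<close>
    define c where "c = real k * (real k + 5) / e"
    have c: "0 < c" using e k by (auto simp: c_def)
    then obtain z w where w: "0 < w" and zM: "\<And>i. i \<le> k \<Longrightarrow> z i \<in> M"
      and step: "\<And>i. i < k \<Longrightarrow> (z i, z (Suc i)) \<in> T \<and> c * w \<le> dist (z i) (z (Suc i))"
      and close: "\<And>i j. i \<le> k \<Longrightarrow> j \<le> k \<Longrightarrow> even i = even j \<Longrightarrow> dist (z i) (z j) \<le> w"
      using snakes unfolding long_snakes_def by metis
    \<comment> \<open>Distinctness is not part of \<open>long_snakes\<close>: neighbours differ
      since \<open>c * w > 0\<close>, and antisymmetry excludes a later return.\<close>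
    have less: "(z i, z j) \<in> T \<and> z i \<noteq> z j" if "i < j" "j \<le> k" for i j
      using that
    proof (induction j)
      case (Suc j)
      have "0 < c * w" using c w by simp
      then have j: "(z j, z (Suc j)) \<in> T" "z j \<noteq> z (Suc j)"
        using step[of j] Suc.prems by auto
      show ?case
      proof (cases "i = j")
        case False
        then have "(z i, z j) \<in> T" using Suc by simp
        then show ?thesis using j tr an by (metis antisymD transD)
      qed (use j in auto)
    qed simp
    have inj: "inj_on z {..k}"
      by (rule inj_onI) (metis atMost_iff less linorder_neqE_nat)
    define X where "X = z ` {..k}"
    have X: "X \<subseteq> M" "finite X" "card X = Suc k"
      using zM card_image[OF inj] by (auto simp: X_def)
    have "order_enum T X = map z [0..<Suc k]"
    proof (rule order_enum_eqI[OF T X(1)])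
      show "set (map z [0..<Suc k]) = X" by (auto simp: X_def simp del: upt_Suc)
      show "distinct (map z [0..<Suc k])"
        using inj by (auto simp: distinct_map atLeast0LessThan lessThan_Suc_atMost simp del: upt_Suc)
      show "sorted_wrt (\<lambda>x y. (x, y) \<in> T) (map z [0..<Suc k])"
        using less by (auto simp: sorted_wrt_iff_nth_less simp del: upt_Suc)
    qed
    then have l_ord: "l_ord T X = (\<Sum>i<k. dist (z i) (z (Suc i)))"
      by (simp add: l_ord_def path_length_def del: upt_Suc)
    define d where "d = dist (z 0) (z 1)"
    have d: "c * w \<le> d" using step[of 0] k by (simp add: d_def)
    have cross: "dist (z i) (z j) \<le> d + 2 * w \<and> d - 2 * w \<le> dist (z i) (z j)"
      if "i \<le> k" "j \<le> k" "even i" "odd j" for i j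
    proof -
      have "dist (z i) (z 0) \<le> w" "dist (z j) (z 1) \<le> w"
        using close[of i 0] close[of j 1] that k by auto
      then show ?thesis
        using dist_triangle[of "z i" "z j" "z 0"] dist_triangle[of "z 0" "z j" "z 1"]
          dist_triangle[of "z 0" "z 1" "z i"] dist_triangle[of "z i" "z 1" "z j"]
        unfolding d_def by (simp add: dist_commute)
    qed
    have "real k * (d - 2 * w) = (\<Sum>i<k. d - 2 * w)" by simp
    also have "\<dots> \<le> l_ord T X"
      unfolding l_ord
    proof (rule sum_mono)
      fix i assume "i \<in> {..<k}"
      then show "d - 2 * w \<le> dist (z i) (z (Suc i))"
        using cross[of i "Suc i"] cross[of "Suc i" i] by (cases "even i") (auto simp: dist_commute)
    qed
    finally have lower: "real k * (d - 2 * w) \<le> l_ord T X" .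
    \<comment> \<open>The competitor for \<open>l_opt\<close>: first the even cluster, then the odd
      one.\<close>
    define as where "as = map z (filter even [0..<Suc k])"
    define bs where "bs = map z (filter odd [0..<Suc k])"
    have set: "set as = z ` {i. i \<le> k \<and> even i}" "set bs = z ` {i. i \<le> k \<and> odd i}"
      by (auto simp: as_def bs_def simp del: upt_Suc)
    have len: "length (as @ bs) = Suc k"
      unfolding as_def bs_def length_append length_map sum_length_filter_compl by simp
    have setX: "set (as @ bs) = X" by (auto simp: set X_def)
    then have "as @ bs \<in> permutations_of_set X"
      using len X(3) card_distinct[of "as @ bs"] by (simp add: permutations_of_set_def)
    then have "l_opt X \<le> path_length (as @ bs)"
      unfolding l_opt_def by (intro Min_le) auto
    also have "\<dots> \<le> real (length (as @ bs)) * w + (d + 2 * w)"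
      by (rule path_length_two_clusters) (use w close cross in \<open>auto simp: set d_def\<close>)
    also have "\<dots> = d + (real k + 3) * w" unfolding len by (simp add: algebra_simps)
    finally have upper: "l_opt X \<le> d + (real k + 3) * w" .
    have pos: "0 < l_opt X" using l_opt_pos[OF X(2)] X(3) k by simp
    have "(real k - e) * l_opt X \<le> l_ord T X"
    \<comment> \<open>The bound \<open>upper\<close> can only be multiplied by \<open>k - e\<close>
      when this factor is nonnegative; otherwise the left side is at most 0.\<close>
    proof (cases "real k \<le> e")
      case True
      have "(real k - e) * l_opt X \<le> 0" using True pos by (simp add: mult_nonpos_nonneg)
      moreover have "0 \<le> l_ord T X" unfolding l_ord by (simp add: sum_nonneg)
      ultimately show ?thesis by linarith
    next
      case False
      have "real k * (real k + 5) * w = e * (c * w)" using e by (simp add: c_def)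
      also have "\<dots> \<le> e * d" using d e by simp
      finally have "real k * (real k + 5) * w \<le> e * d" .
      moreover have "0 \<le> e * ((real k + 3) * w)" using e w by simp
      ultimately have "(real k - e) * (d + (real k + 3) * w) \<le> real k * (d - 2 * w)"
        by (simp add: algebra_simps)
      moreover have "(real k - e) * l_opt X \<le> (real k - e) * (d + (real k + 3) * w)"
        using False upper by (intro mult_left_mono) auto
      ultimately show ?thesis using lower by linarith
    qed
    then have "real k - e \<le> l_ord T X / l_opt X" using pos by (simp add: le_divide_eq)
    also have "\<dots> \<le> (SUP X\<in>{X. X \<subseteq> M \<and> finite X \<and> 2 \<le> card X \<and> card X \<le> k + 1}. l_ord T X / l_opt X)"
      using X k by (intro cSUP_upper bdd_above_ord_ratios[OF T]) auto
    also have "\<dots> = ord_ratio_wrt M T k"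
      using less[of 0 1] zM[of 0] zM[of 1] k unfolding ord_ratio_wrt_def by auto
    finally show "real k \<le> ord_ratio_wrt M T k + e" by simp
  qed
qed

section \<open>Transfer along quasi-isometric embeddings\<close>

text \<open>As \<open>k\<close> bounds the ratio of every order from above, the infimum over orders
  equals \<open>k\<close> only if each order attains it. This reduces the problem to one order at a
  time.\<close>

lemma ord_ratio_eq_iff:
  assumes "1 \<le> k"
  shows "ord_ratio M k = real k \<longleftrightarrow> (\<forall>T. linear_order_on M T \<longrightarrow> ord_ratio_wrt M T k = real k)"
proof
  assume eq: "ord_ratio M k = real k"
  show "\<forall>T. linear_order_on M T \<longrightarrow> ord_ratio_wrt M T k = real k"
  proof (intro allI impI antisym)
    fix T assume T: "linear_order_on M T"
    show "ord_ratio_wrt M T k \<le> real k" using ord_ratio_wrt_le[OF T assms] .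
    have "bdd_below ((\<lambda>T. ord_ratio_wrt M T k) ` {T. linear_order_on M T})"
      by (rule bdd_belowI2[of _ 1]) (use ord_ratio_wrt_ge_1 assms in auto)
    then have "ord_ratio M k \<le> ord_ratio_wrt M T k"
      unfolding ord_ratio_def using T by (intro cINF_lower) auto
    then show "real k \<le> ord_ratio_wrt M T k" using eq by simp
  qed
next
  assume "\<forall>T. linear_order_on M T \<longrightarrow> ord_ratio_wrt M T k = real k"
  then have "ord_ratio M k = (INF T\<in>{T. linear_order_on M T}. real k)"
    unfolding ord_ratio_def by (intro INF_cong) auto
  also have "\<dots> = real k" using linear_order_exists[of M] by (intro cINF_const) auto
  finally show "ord_ratio M k = real k" .
qed

text \<open>Points are compared by their images first; an auxiliary order \<open>R\<close> decides
  inside the fibres of \<open>\<alpha>\<close>, which need not be injective.\<close>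

lemma linear_order_pullback:
  assumes T: "linear_order_on M T" and \<alpha>: "\<alpha> \<in> N \<rightarrow> M"
  obtains S where "linear_order_on N S" "\<And>x y. (x, y) \<in> S \<Longrightarrow> (\<alpha> x, \<alpha> y) \<in> T"
proof -
  obtain R where R: "linear_order_on N R" using linear_order_exists by blast
  define S where "S = {(x, y). x \<in> N \<and> y \<in> N \<and> (if \<alpha> x = \<alpha> y then (x, y) \<in> R else (\<alpha> x, \<alpha> y) \<in> T)}"
  have rR: "refl_on N R" "R \<subseteq> N \<times> N" "trans R" "antisym R" "total_on N R"
    and rT: "refl_on M T" "T \<subseteq> M \<times> M" "trans T" "antisym T" "total_on M T"
    using R T unfolding order_on_defs by auto
  show thesis
  proof
    have "refl_on N S" using rR by (auto simp: S_def refl_on_def)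
    moreover have "S \<subseteq> N \<times> N" by (auto simp: S_def)
    moreover have "trans S"
    proof (rule transI)
      fix x y v assume "(x, y) \<in> S" "(y, v) \<in> S"
      then show "(x, v) \<in> S"
        using rR(3) rT(3,4) unfolding S_def
        by (auto split: if_splits dest: transD antisymD)
    qed
    moreover have "antisym S"
      using rR(4) rT(4) by (auto simp: S_def antisym_def split: if_splits)
    moreover have "total_on N S"
      using rR(5) rT(5) \<alpha> by (auto simp: S_def total_on_def Pi_iff)
    ultimately show "linear_order_on N S" unfolding order_on_defs by auto
    show "(\<alpha> x, \<alpha> y) \<in> T" if "(x, y) \<in> S" for x y
      using that rT(1) \<alpha> by (auto simp: S_def refl_on_def split: if_splits)
  qed
qed

text \<open>Discreteness forces snakes to have width \<open>w \<ge> \<delta>\<close>, so the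
  additive constant \<open>C2\<close> is at most \<open>C2 / \<delta> * w\<close>: at the scale of a
  snake it acts like a multiplicative one.\<close>

lemma ord_ratio_eq_quasi_isometric_embedding:
  assumes k: "2 \<le> k" and N: "uniform_discrete N" and eq: "ord_ratio N k = real k"
    and \<alpha>: "quasi_isometric_embedding N M \<alpha>"
  shows "ord_ratio M k = real k"
proof -
  obtain \<delta> where \<delta>: "0 < \<delta>" "\<And>x y. x \<in> N \<Longrightarrow> y \<in> N \<Longrightarrow> dist x y < \<delta> \<Longrightarrow> x = y"
    using N unfolding uniform_discrete_def by blast
  obtain C1 C2 where \<alpha>M: "\<alpha> \<in> N \<rightarrow> M" and C: "1 \<le> C1" "0 \<le> C2"
    and qi: "\<And>x y. x \<in> N \<Longrightarrow> y \<in> N \<Longrightarrow>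
      1 / C1 * dist x y - C2 \<le> dist (\<alpha> x) (\<alpha> y) \<and> dist (\<alpha> x) (\<alpha> y) \<le> C1 * dist x y + C2"
    using \<alpha> unfolding quasi_isometric_embedding_def by metis
  have "ord_ratio_wrt M T k = real k" if T: "linear_order_on M T" for T
  proof (rule ord_ratio_wrt_eq_if_long_snakes[OF T k])
    obtain S where S: "linear_order_on N S" "\<And>x y. (x, y) \<in> S \<Longrightarrow> (\<alpha> x, \<alpha> y) \<in> T"
      using linear_order_pullback[OF T \<alpha>M] by blast
    have "long_snakes N S k"
      using long_snakes_if_ord_ratio_wrt_eq[OF S(1) k] ord_ratio_eq_iff[of k N] eq k S(1) by simp
    show "long_snakes M T k"
      unfolding long_snakes_def
    proof (intro allI impI)
      fix c :: real
      assume c: "0 < c"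
      \<comment> \<open>The image snake has width \<open>(C1 + C2 / \<delta>) * w\<close>. After
        division by \<open>C1\<close> and loss of \<open>C2\<close>, a step of length
        \<open>c' * w\<close> must still be \<open>c\<close> times that width.\<close>
      define c' where "c' = C1 * (c * (C1 + C2 / \<delta>) + C2 / \<delta>)"
      have K: "0 < C1 + C2 / \<delta>" using C \<delta> by (intro add_pos_nonneg) auto
      then have "0 < c'" using c C \<delta> unfolding c'_def by (intro mult_pos_pos add_pos_nonneg) auto
      then obtain z w where w: "0 < w" and zN: "\<And>i. i \<le> k \<Longrightarrow> z i \<in> N"
        and step: "\<And>i. i < k \<Longrightarrow> (z i, z (Suc i)) \<in> S \<and> c' * w \<le> dist (z i) (z (Suc i))"
        and close: "\<And>i j. i \<le> k \<Longrightarrow> j \<le> k \<Longrightarrow> even i = even j \<Longrightarrow> dist (z i) (z j) \<le> w"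
        using \<open>long_snakes N S k\<close> unfolding long_snakes_def by metis
      \<comment> \<open>Two distinct points of one cluster, available because
        \<open>k \<ge> 2\<close>; their distance gives \<open>\<delta> \<le> w\<close>.\<close>
      have "z 0 \<noteq> z 2"
      proof
        assume "z 0 = z 2"
        then have "(z 0, z 1) \<in> S" "(z 1, z 0) \<in> S"
          using step[of 0] step[of 1] k by (auto simp: numeral_2_eq_2)
        then have "z 0 = z 1" using S(1) unfolding order_on_defs by (auto dest: antisymD)
        then show False using step[of 0] k mult_pos_pos[OF \<open>0 < c'\<close> w] by simp
      qed
      then have "\<delta> \<le> dist (z 0) (z 2)" using \<delta>(2)[of "z 0" "z 2"] zN k by force
      also have "\<dots> \<le> w" using close[of 0 2] k by simp
      finally have "C2 / \<delta> * \<delta> \<le> C2 / \<delta> * w" using C \<delta> by (intro mult_left_mono) auto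
      then have C2w: "C2 \<le> C2 / \<delta> * w" using \<delta> by simp
      show "\<exists>z w. 0 < w \<and> (\<forall>i\<le>k. z i \<in> M) \<and>
          (\<forall>i<k. (z i, z (Suc i)) \<in> T \<and> c * w \<le> dist (z i) (z (Suc i))) \<and>
          (\<forall>i\<le>k. \<forall>j\<le>k. even i = even j \<longrightarrow> dist (z i) (z j) \<le> w)"
      proof (rule exI[of _ "\<alpha> \<circ> z"], rule exI[of _ "(C1 + C2 / \<delta>) * w"], intro conjI allI impI)
        show "0 < (C1 + C2 / \<delta>) * w" using K w by simp
        show "(\<alpha> \<circ> z) i \<in> M" if "i \<le> k" for i using zN[OF that] \<alpha>M by auto
        fix i
        assume i: "i < k"
        show "((\<alpha> \<circ> z) i, (\<alpha> \<circ> z) (Suc i)) \<in> T" using step[OF i] S(2) by simp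
        have "c * ((C1 + C2 / \<delta>) * w) + C2 / \<delta> * w = 1 / C1 * (c' * w)"
          using C by (simp add: c'_def distrib_right)
        also have "\<dots> \<le> 1 / C1 * dist (z i) (z (Suc i))"
          using step[OF i] C by (intro mult_left_mono) auto
        also have "\<dots> \<le> dist (\<alpha> (z i)) (\<alpha> (z (Suc i))) + C2"
          using qi[of "z i" "z (Suc i)"] zN[of i] zN[of "Suc i"] i by simp
        finally show "c * ((C1 + C2 / \<delta>) * w) \<le> dist ((\<alpha> \<circ> z) i) ((\<alpha> \<circ> z) (Suc i))"
          using C2w by simp
      next
        fix i j
        assume ij: "i \<le> k" "j \<le> k" "even i = even j"
        have "dist (\<alpha> (z i)) (\<alpha> (z j)) \<le> C1 * dist (z i) (z j) + C2"
          using qi zN ij by blast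
        also have "\<dots> \<le> C1 * w + C2 / \<delta> * w"
          using close[OF ij] C C2w by (intro add_mono mult_left_mono) auto
        finally show "dist ((\<alpha> \<circ> z) i) ((\<alpha> \<circ> z) j) \<le> (C1 + C2 / \<delta>) * w"
          by (simp add: distrib_right)
      qed
    qed
  qed
  then show ?thesis using ord_ratio_eq_iff[of k M] k by simp
qed

section \<open>Breakpoints and coarse inverses\<close>

text \<open>By contraposition of the transfer result, if an order on \<open>M\<close> breaks at
  \<open>s\<close>, then some order on \<open>N\<close> has ratio below \<open>s\<close> at the same
  \<open>s\<close>.\<close>

lemma breakpoint_le_quasi_isometric_embedding:
  assumes N: "uniform_discrete N" and \<alpha>: "quasi_isometric_embedding N M \<alpha>"
  shows "breakpoint N \<le> breakpoint M"
  unfolding breakpoint_def[of M]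
proof (rule INF_greatest)
  fix T assume "T \<in> {T. linear_order_on M T}"
  then have T: "linear_order_on M T" by simp
  show "breakpoint N \<le> breakpoint_wrt M T"
  proof (cases "\<exists>s\<ge>1. ord_ratio_wrt M T s < real s")
    case True
    define s where "s = (LEAST s. 1 \<le> s \<and> ord_ratio_wrt M T s < real s)"
    have s: "1 \<le> s" "ord_ratio_wrt M T s < real s"
      using LeastI_ex[OF True] by (auto simp: s_def)
    \<comment> \<open>Ratios are at least 1, so no order breaks at 1 and the transfer result
      applies.\<close>
    have "2 \<le> s" using s ord_ratio_wrt_ge_1[OF T s(1)] by linarith
    moreover have "ord_ratio M s \<noteq> real s" using ord_ratio_eq_iff[OF s(1), of M] T s by force
    ultimately have "ord_ratio N s \<noteq> real s"
      using ord_ratio_eq_quasi_isometric_embedding[OF _ N _ \<alpha>] by blast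
    then obtain S where S: "linear_order_on N S" "ord_ratio_wrt N S s \<noteq> real s"
      using ord_ratio_eq_iff[OF s(1)] by blast
    then have lt: "ord_ratio_wrt N S s < real s" using ord_ratio_wrt_le[OF S(1) s(1)] by simp
    have "breakpoint N \<le> breakpoint_wrt N S"
      unfolding breakpoint_def using S by (intro INF_lower) auto
    also have "\<dots> \<le> enat s"
      using lt s(1) by (auto simp: breakpoint_wrt_def intro: Least_le)
    also have "\<dots> = breakpoint_wrt M T" using True by (simp add: breakpoint_wrt_def s_def)
    finally show ?thesis .
  next
    case False
    then have "breakpoint_wrt M T = \<infinity>" unfolding breakpoint_wrt_def by (simp only: if_False)
    then show ?thesis by simp
  qed
qed

text \<open>A coarse inverse: \<open>\<beta> y\<close> is any point whose image under
  \<open>\<alpha>\<close> lies within \<open>C\<close> of \<open>y\<close>.\<close>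

lemma quasi_isometry_inverse:
  assumes "quasi_isometry N M \<alpha>"
  obtains \<beta> where "quasi_isometric_embedding M N \<beta>"
proof -
  obtain C1 C2 C where C1: "1 \<le> C1" "0 \<le> C2"
    and qi: "\<And>x y. x \<in> N \<Longrightarrow> y \<in> N \<Longrightarrow>
      1 / C1 * dist x y - C2 \<le> dist (\<alpha> x) (\<alpha> y) \<and> dist (\<alpha> x) (\<alpha> y) \<le> C1 * dist x y + C2"
    and C: "\<And>y. y \<in> M \<Longrightarrow> \<exists>x\<in>N. dist y (\<alpha> x) \<le> C"
    using assms unfolding quasi_isometry_def quasi_isometric_embedding_def by metis
  obtain \<beta> where \<beta>: "\<And>y. y \<in> M \<Longrightarrow> \<beta> y \<in> N \<and> dist y (\<alpha> (\<beta> y)) \<le> C"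
    using C by metis
  \<comment> \<open>Replacing \<open>x\<close> and \<open>y\<close> by
    \<open>\<alpha> (\<beta> x)\<close> and \<open>\<alpha> (\<beta> y)\<close> costs
    \<open>2 * \<bar>C\<bar>\<close>; the absolute value is taken since the sign of \<open>C\<close>
    is not given. The factor \<open>C1\<close> comes from solving the lower estimate for
    \<open>dist (\<beta> x) (\<beta> y)\<close>.\<close>
  define D where "D = C1 * (2 * \<bar>C\<bar> + C2)"
  have "1 / C1 * dist x y - D \<le> dist (\<beta> x) (\<beta> y) \<and> dist (\<beta> x) (\<beta> y) \<le> C1 * dist x y + D"
    if "x \<in> M" "y \<in> M" for x y
  proof
    have d: "dist x y \<le> dist (\<alpha> (\<beta> x)) (\<alpha> (\<beta> y)) + 2 * \<bar>C\<bar>"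
      "dist (\<alpha> (\<beta> x)) (\<alpha> (\<beta> y)) \<le> dist x y + 2 * \<bar>C\<bar>"
      using \<beta>[OF that(1)] \<beta>[OF that(2)] by metric+
    note q = qi[of "\<beta> x" "\<beta> y"]
    have "dist x y \<le> C1 * dist (\<beta> x) (\<beta> y) + (2 * \<bar>C\<bar> + C2)"
      using d q \<beta> that by force
    also have "\<dots> \<le> C1 * dist (\<beta> x) (\<beta> y) + C1 * D"
    proof -
      have "1 * (2 * \<bar>C\<bar> + C2) \<le> (C1 * C1) * (2 * \<bar>C\<bar> + C2)"
        using C1 mult_mono[of 1 C1 1 C1] by (intro mult_right_mono) auto
      then show ?thesis by (simp add: D_def mult.assoc)
    qed
    finally show "1 / C1 * dist x y - D \<le> dist (\<beta> x) (\<beta> y)"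
      using C1 by (simp add: field_simps)
    have "1 / C1 * dist (\<beta> x) (\<beta> y) \<le> dist x y + 2 * \<bar>C\<bar> + C2"
      using d q \<beta> that by force
    then show "dist (\<beta> x) (\<beta> y) \<le> C1 * dist x y + D"
      using C1 by (simp add: D_def field_simps)
  qed
  moreover have "0 \<le> D" using C1 by (simp add: D_def)
  ultimately have "quasi_isometric_embedding M N \<beta>"
    unfolding quasi_isometric_embedding_def using C1 \<beta> by blast
  then show thesis by (rule that)
qed

theorem lemma2p13:
  fixes N :: "'a::metric_space set" and M :: "'b::metric_space set"
  shows "(\<forall>(k::nat) (\<alpha>::'a \<Rightarrow> 'b).
            k \<ge> 2 \<and> uniform_discrete N \<and> ord_ratio N k = real k \<and> quasi_isometric_embedding N M \<alpha>
              \<longrightarrow> ord_ratio M k = real k)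
       \<and> (uniform_discrete N \<and> uniform_discrete M \<and> quasi_isometric N M
              \<longrightarrow> breakpoint N = breakpoint M)"
proof (intro conjI allI impI)
  fix k and \<alpha> :: "'a \<Rightarrow> 'b"
  assume "k \<ge> 2 \<and> uniform_discrete N \<and> ord_ratio N k = real k \<and> quasi_isometric_embedding N M \<alpha>"
  then show "ord_ratio M k = real k"
    using ord_ratio_eq_quasi_isometric_embedding by blast
next
  assume "uniform_discrete N \<and> uniform_discrete M \<and> quasi_isometric N M"
  then obtain \<alpha> where ud: "uniform_discrete N" "uniform_discrete M" and \<alpha>: "quasi_isometry N M \<alpha>"
    unfolding quasi_isometric_def by blast
  obtain \<beta> where "quasi_isometric_embedding M N \<beta>"
    using quasi_isometry_inverse[OF \<alpha>] .
  \<comment> \<open>One inequality comes from \<alpha> and discreteness of \<open>N\<close>, the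
    other from \<beta> and discreteness of \<open>M\<close>.\<close>
  then show "breakpoint N = breakpoint M"
    using ud \<alpha> breakpoint_le_quasi_isometric_embedding unfolding quasi_isometry_def
    by (metis antisym)
qed

end
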